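(* There exist a metric space $X$, starting positions $x_A,x_B\in X$ and a target $y\in X$ such that in the race to a point game on $X$, with Player A starting at $x_A$, Player B starting at $x_B$ and target $y$, neither player has a drawing strategy.
   Context: Race to a point game on a metric space $X$ with starting points $x_A$ (Player A), $x_B$ (Player B) and target $y$. A path of Player A is a function $p:[0,\infty)\to X$ with $d(p(s),p(t))\le|s-t|$ for all $s,t$ and $p(0)=x_A$; similarly for Player B with $x_B$. Given paths of the two players, the player whose path first reaches the target strictly before the other's does (in particular if the other's never reaches it) wins; the game is a draw if both reach the target for the first time at the same time or if neither ever reaches it. A strategy for a player is a function $G$ from the set of the opponent's paths to the set of the player's own paths satisfying the no-lookahead rule: if opponent paths $p,p'$ agree on $[0,t]$ then $G(p)$ and $G(p')$ agree on $[0,t]$. A drawing strategy for a player is a strategy $G$ such that for every opponent path $p$, when the opponent follows $p$ and the player follows $G(p)$, the player either wins or draws. *)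

theory Defs
  imports "HOL-Analysis.Abstract_Metric_Spaces" "HOL-Library.FuncSet"
begin

text \<open>
  A metric space is a carrier \<open>X\<close> with a distance \<open>d\<close>, as in the locale \<open>Metric_space\<close>.
  Paths are functions on \<open>[0,\<infinity>)\<close>, hence extensional on \<open>{0..}\<close>.
\<close>

definition paths :: "'a set \<Rightarrow> ('a \<Rightarrow> 'a \<Rightarrow> real) \<Rightarrow> 'a \<Rightarrow> (real \<Rightarrow> 'a) set" where
  "paths X d x = {p \<in> {0..} \<rightarrow>\<^sub>E X. p 0 = x \<and> (\<forall>s\<ge>0. \<forall>t\<ge>0. d (p s) (p t) \<le> \<bar>s - t\<bar>)}"

definition first_reaches :: "(real \<Rightarrow> 'a) \<Rightarrow> 'a \<Rightarrow> real \<Rightarrow> bool" where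
  "first_reaches p y t \<longleftrightarrow> 0 \<le> t \<and> p t = y \<and> (\<forall>s. 0 \<le> s \<and> s < t \<longrightarrow> p s \<noteq> y)"

text \<open>In \<open>wins\<close> and \<open>draws\<close>, \<open>p\<close> is the player's own path and \<open>q\<close> is the opponent's.\<close>

definition wins :: "'a \<Rightarrow> (real \<Rightarrow> 'a) \<Rightarrow> (real \<Rightarrow> 'a) \<Rightarrow> bool" where
  "wins y p q \<longleftrightarrow> (\<exists>t. first_reaches p y t \<and> (\<forall>s\<ge>0. q s = y \<longrightarrow> t < s))"

definition draws :: "'a \<Rightarrow> (real \<Rightarrow> 'a) \<Rightarrow> (real \<Rightarrow> 'a) \<Rightarrow> bool" where
  "draws y p q \<longleftrightarrow>
     (\<exists>t. first_reaches p y t \<and> first_reaches q y t) \<or> (\<forall>t\<ge>0. p t \<noteq> y \<and> q t \<noteq> y)"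

text \<open>
  Below, \<open>x\<close> is the starting point of the player using the strategy and \<open>x'\<close> that of the
  opponent. Only the values of \<open>G\<close> on the opponent's paths matter.
\<close>

definition strategy ::
  "'a set \<Rightarrow> ('a \<Rightarrow> 'a \<Rightarrow> real) \<Rightarrow> 'a \<Rightarrow> 'a \<Rightarrow> ((real \<Rightarrow> 'a) \<Rightarrow> (real \<Rightarrow> 'a)) \<Rightarrow> bool" where
  "strategy X d x x' G \<longleftrightarrow>
     G \<in> paths X d x' \<rightarrow> paths X d x \<and>
     (\<forall>p\<in>paths X d x'. \<forall>p'\<in>paths X d x'. \<forall>t\<ge>0.
        (\<forall>s\<in>{0..t}. p s = p' s) \<longrightarrow> (\<forall>s\<in>{0..t}. G p s = G p' s))"

definition drawing_strategy ::
  "'a set \<Rightarrow> ('a \<Rightarrow> 'a \<Rightarrow> real) \<Rightarrow> 'a \<Rightarrow> 'a \<Rightarrow> 'a \<Rightarrow> ((real \<Rightarrow> 'a) \<Rightarrow> (real \<Rightarrow> 'a)) \<Rightarrow> bool" where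
  "drawing_strategy X d x x' y G \<longleftrightarrow>
     strategy X d x x' G \<and> (\<forall>p\<in>paths X d x'. wins y (G p) p \<or> draws y (G p) p)"

end

theory Submission
  imports Defs "HOL-Analysis.Elementary_Metric_Spaces"
begin

text \<open>
  Each player gets a spine, a segment leaving the starting point, with a tooth above every
  point of the spine; running up a tooth to its end leads to the target.  Tooth lengths are such
  that leaving the spine earlier gives an earlier arrival, but only slightly, and the starting
  point itself carries no tooth.  So there is no fastest route, and each player would like to
  leave earlier than the opponent.

  If both combs were equal, a player could still draw by leaving the spine at the very moment
  the opponent does.  To prevent this, each spine has a toll, a tenth of which is added to the
  length of the tooth.
  The first player's toll vanishes at distances \<open>4\<^sup>-\<^sup>n\<close> from the start and the second player's at
  distances \<open>4\<^sup>-\<^sup>n / 2\<close>, and at the toll-free distances of one player the toll of the other is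
  comparable to the distance.

  Fix a strategy of one player and let the opponent just walk along the spine.  At each of
  the opponent's toll-free times \<open>s\<close> the opponent could leave, and without lookahead the strategy
  has to be ready for this: at time \<open>s\<close> the player must already be as close to the target as the
  opponent (\<open>drawing_strategy_dist_le\<close>).  This is possible only by having entered a
  tooth at a distance of at most \<open>3/4 s\<close> and having run up most of the remaining time
  (\<open>position_if_on_schedule\<close>).  Between the toll-free times \<open>s\<close> and \<open>4 s\<close> there is not enough time
  to come down from such a depth and to run up a later tooth far enough.  Hence the player is in
  the same tooth at all toll-free times.  These tend to \<open>0\<close>, so the tooth would have to stand at
  the starting point, where there is none (\<open>no_drawing_strategy\<close>).
\<close>

section \<open>The comb metric of the plane\<close>

text \<open>
  The horizontal axis is the spine and the vertical lines are the teeth: a route between different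
  vertical lines passes through the axis.
\<close>

definition river :: "real \<times> real \<Rightarrow> real \<times> real \<Rightarrow> real" where
  "river p q =
     (if fst p = fst q then \<bar>snd p - snd q\<bar> else \<bar>snd p\<bar> + \<bar>fst p - fst q\<bar> + \<bar>snd q\<bar>)"

lemma river_nonneg: "0 \<le> river p q"
  by (simp add: river_def)

lemma river_commute: "river p q = river q p"
  by (simp add: river_def abs_minus_commute)

lemma river_eq_0_iff: "river p q = 0 \<longleftrightarrow> p = q"
  by (auto simp: river_def prod_eq_iff)

lemma river_triangle: "river p r \<le> river p q + river q r"
  unfolding river_def by (auto split: if_splits)

section \<open>Readiness of a drawing strategy\<close>

text \<open>
  If the opponent leaves the course \<open>w\<close> at time \<open>s\<close> and is at the target \<open>r\<close> later, the player has
  to be there by then, and speed is at most 1.  Since the strategy cannot foresee the change of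
  course, its answer to \<open>w\<close> alone already has to be within distance \<open>r\<close> at time \<open>s\<close>.  The
  assumption \<open>far\<close> excludes that the player has been at the target before \<open>s\<close> and left it again.
\<close>

lemma drawing_strategy_dist_le:
  assumes G: "drawing_strategy X d x x' y G"
    and p: "p \<in> paths X d x'" and w: "w \<in> paths X d x'"
    and agree: "\<And>t. 0 \<le> t \<Longrightarrow> t \<le> s \<Longrightarrow> p t = w t"
    and reach: "p (s + r) = y"
    and "0 \<le> s" "0 \<le> r" and far: "s \<le> d x y"
  shows "d (G w s) y \<le> r"
proof -
  have strat: "strategy X d x x' G" and ok: "wins y (G p) p \<or> draws y (G p) p"
    using G p by (auto simp: drawing_strategy_def)
  have same: "G p s = G w s"
    using strat p w agree \<open>0 \<le> s\<close> unfolding strategy_def by (meson atLeastAtMost_iff order_refl)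
  have Gp: "G p \<in> paths X d x"
    using strat p by (auto simp: strategy_def)
  obtain t where t: "0 \<le> t" "t \<le> s + r" "G p t = y"
    using ok reach \<open>0 \<le> s\<close> \<open>0 \<le> r\<close> unfolding wins_def draws_def first_reaches_def
    by (smt (verit))
  have lip: "d (G p a) (G p b) \<le> \<bar>a - b\<bar>" if "0 \<le> a" "0 \<le> b" for a b
    using Gp that by (simp add: paths_def)
  have "d x y \<le> t"
    using lip[of 0 t] t Gp by (simp add: paths_def)
  moreover have "d (G p s) y \<le> \<bar>s - t\<bar>"
    using lip[of s t] t \<open>0 \<le> s\<close> by simp
  ultimately show ?thesis
    using far t same by simp
qed

section \<open>Two combs glued at the target\<close>

locale toll_race =
  fixes toll :: "real \<Rightarrow> real"
  assumes toll_nonneg: "0 \<le> toll u"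
    and toll_lipschitz: "\<bar>toll u - toll v\<bar> \<le> \<bar>u - v\<bar>"
begin

text \<open>
  The distance that remains to the end of the tooth when running straight up.  Leaving the
  spine at \<open>u\<close> after a walk of length \<open>\<bar>u\<bar> - 1\<close> gives the total \<open>2 + \<bar>u\<bar> / 10\<close> plus a tenth of the
  toll, so leaving early pays off.  The slope \<open>9/10\<close> is chosen close to 1 so that this gain is
  small compared with the time lost by changing teeth (any slope strictly between \<open>15/17\<close> and 1
  would do).  The slopes \<open>9/10\<close> and
  \<open>1/10\<close> add up to 1, which makes the function 1-Lipschitz, and the constant 3 keeps both
  players at distance more than 1 from the target up to time 1.
\<close>

definition rest :: "real \<times> real \<Rightarrow> real" where
  "rest p = max 0 (3 - 9/10 * \<bar>fst p\<bar> + 1/10 * toll (fst p) - \<bar>snd p\<bar>)"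

text \<open>
  The second alternative is the route through the target, where all ends of teeth are identified.
\<close>

definition race_dist :: "real \<times> real \<Rightarrow> real \<times> real \<Rightarrow> real" where
  "race_dist p q = min (river p q) (rest p + rest q)"

text \<open>
  All points with \<open>rest p = 0\<close> are at distance 0 from each other, so any of them can represent
  the target.
\<close>

definition target :: "real \<times> real" where
  "target = (1, rest (1, 0))"

text \<open>
  Both combs lie in one plane, at \<open>u \<ge> 1\<close> and \<open>u \<le> -1\<close>.  The gap between them has
  width 2, so that nobody gets across it by time 1.  The starting
  points \<open>u = 1\<close> and \<open>u = -1\<close> carry no tooth.
\<close>

definition board :: "(real \<times> real) set" where
  "board = insert target {p. 0 < rest p \<and> (1 < \<bar>fst p\<bar> \<or> \<bar>fst p\<bar> = 1 \<and> snd p = 0)}"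

lemma rest_nonneg: "0 \<le> rest p"
  by (simp add: rest_def)

lemma rest_target: "rest target = 0"
  using toll_nonneg[of 1] by (simp add: rest_def target_def)

lemma rest_lipschitz: "rest p \<le> rest q + river p q"
  using toll_lipschitz[of "fst p" "fst q"]
  unfolding rest_def river_def by (auto simp: max_def abs_if split: if_splits)

lemma race_dist_le_river: "race_dist p q \<le> river p q"
  by (simp add: race_dist_def)

lemma race_dist_target: "race_dist p target = rest p"
  using rest_lipschitz[of p target] by (simp add: race_dist_def rest_target)

lemma race_dist_commute: "race_dist p q = race_dist q p"
  by (simp add: race_dist_def river_commute add.commute)

text \<open>
  Gluing along the zeros of a nonnegative 1-Lipschitz function always gives a pseudometric; on the
  board it separates points because the target is the only zero there.
\<close>

lemma Metric_space_race: "Metric_space board race_dist"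
proof
  show "0 \<le> race_dist p q" for p q
    by (simp add: race_dist_def river_nonneg rest_nonneg)
  show "race_dist p q = race_dist q p" for p q
    by (rule race_dist_commute)
  show "race_dist p q = 0 \<longleftrightarrow> p = q" if "p \<in> board" "q \<in> board" for p q
  proof
    assume "race_dist p q = 0"
    then consider "river p q = 0" | "rest p + rest q = 0"
      by (auto simp: race_dist_def min_def split: if_splits)
    then show "p = q"
    proof cases
      case 2
      then have "rest p = 0" "rest q = 0"
        using rest_nonneg[of p] rest_nonneg[of q] by auto
      then show ?thesis
        using that by (auto simp: board_def)
    qed (simp add: river_eq_0_iff)
  next
    assume "p = q"
    then have "river p q = 0" by (simp add: river_eq_0_iff)
    then show "race_dist p q = 0"
      using rest_nonneg[of p] rest_nonneg[of q] by (simp add: race_dist_def)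
  qed
  show "race_dist p r \<le> race_dist p q + race_dist q r" for p q r
    using river_triangle[of p r q] rest_lipschitz[of p q] rest_lipschitz[of r q]
      rest_nonneg[of q] river_commute[of q r]
    unfolding race_dist_def min_def by (auto split: if_splits)
qed

text \<open>
  The projection that performs the gluing.  It is 1-Lipschitz, so paths on the board can be
  described as paths in the plane that ignore the ends of the teeth.
\<close>

definition collapse :: "real \<times> real \<Rightarrow> real \<times> real" where
  "collapse p = (if rest p = 0 then target else p)"

lemma race_dist_collapse: "race_dist (collapse p) (collapse q) \<le> river p q"
  using rest_lipschitz[of p q] rest_lipschitz[of q p] river_commute[of p q]
    river_nonneg[of p q] race_dist_target[of p] race_dist_target[of q]
    race_dist_target[of target] rest_target race_dist_commute[of target q]
    race_dist_le_river[of p q]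
  by (auto simp: collapse_def)

definition run :: "real \<Rightarrow> real \<Rightarrow> real \<Rightarrow> real \<times> real" where
  "run \<sigma> s = restrict (\<lambda>t. collapse (\<sigma> * (1 + min t s), max 0 (t - s))) {0..}"

lemma run_in_paths:
  assumes \<sigma>: "\<sigma> = 1 \<or> \<sigma> = -1" and "0 < s"
  shows "run \<sigma> s \<in> paths board race_dist (\<sigma>, 0)"
proof -
  have "run \<sigma> s t \<in> board" if "0 \<le> t" for t
    using that assms rest_nonneg[of "(\<sigma> * (1 + min t s), max 0 (t - s))"]
    by (auto simp: run_def collapse_def board_def abs_mult max_def min_def split: if_splits)
  moreover have "run \<sigma> s 0 = (\<sigma>, 0)"
    using assms toll_nonneg[of \<sigma>] by (auto simp: run_def collapse_def rest_def)
  moreover have "race_dist (run \<sigma> s a) (run \<sigma> s b) \<le> \<bar>a - b\<bar>" if "0 \<le> a" "0 \<le> b" for a b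
  proof -
    have "river (\<sigma> * (1 + min a s), max 0 (a - s)) (\<sigma> * (1 + min b s), max 0 (b - s)) \<le> \<bar>a - b\<bar>"
      using \<sigma> by (auto simp: river_def min_def max_def)
    then show ?thesis
      using that race_dist_collapse[of "(\<sigma> * (1 + min a s), max 0 (a - s))"
          "(\<sigma> * (1 + min b s), max 0 (b - s))"] by (simp add: run_def)
  qed
  moreover have "run \<sigma> s \<in> extensional {0..}"
    by (simp add: run_def)
  ultimately show ?thesis
    unfolding paths_def by (auto simp: PiE_iff)
qed

lemma run_agree:
  assumes "0 \<le> t" "t \<le> s" "s \<le> s'"
  shows "run \<sigma> s t = run \<sigma> s' t"
  using assms by (simp add: run_def)

lemma run_reaches_target:
  assumes "\<sigma> = 1 \<or> \<sigma> = -1" "0 < s" "s \<le> 1" "toll (\<sigma> * (1 + s)) = 0"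
  shows "run \<sigma> s (s + (3 - 9/10 * (1 + s))) = target"
  using assms by (auto simp: run_def collapse_def rest_def abs_mult)

section \<open>The opponent always beats the strategy\<close>

text \<open>
  The bound \<open>sched\<close> is the distance of the opponent from the target when leaving the spine toll-free
  at time \<open>s\<close>.  Write \<open>x = \<sigma> u - 1\<close> for the distance of the player's tooth from the start and \<open>h\<close>
  for the height in it.  Being on schedule means \<open>9/10 (s - x) + toll / 10 \<le> \<bar>h\<bar>\<close>, while speed 1
  leaves \<open>\<bar>h\<bar> \<le> s - x\<close>; so the toll at \<open>u\<close> is at most \<open>s - x\<close>.  As the toll is at least \<open>s / 2\<close> at
  distance \<open>s\<close> and is 1-Lipschitz, it is also at least \<open>s / 2 - (s - x)\<close>, whence \<open>x \<le> 3/4 s\<close>.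
\<close>

lemma position_if_on_schedule:
  assumes \<sigma>: "\<sigma> = 1 \<or> \<sigma> = -1" and s: "0 < s" "s \<le> 1"
    and q: "q \<in> paths board race_dist (\<sigma>, 0)"
    and sched: "race_dist (q s) target \<le> 3 - 9/10 * (1 + s)"
    and toll: "s / 2 \<le> toll (\<sigma> * (1 + s))"
  shows "1 < \<sigma> * fst (q s)" "\<sigma> * fst (q s) - 1 \<le> 3/4 * s"
    "9/10 * (s - (\<sigma> * fst (q s) - 1)) \<le> \<bar>snd (q s)\<bar>" "1 \<le> rest (q s)"
proof -
  obtain u h where uh: "q s = (u, h)" by (cases "q s")
  have start: "21/10 \<le> rest (\<sigma>, 0)"
    using \<sigma> toll_nonneg[of \<sigma>] by (auto simp: rest_def)
  have "race_dist (\<sigma>, 0) (q s) \<le> s"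
  proof -
    have "race_dist (q 0) (q s) \<le> \<bar>0 - s\<bar>"
      using q s unfolding paths_def by (auto simp del: zero_less_abs_iff)
    then show ?thesis using q s by (simp add: paths_def)
  qed
  then have riv: "river (\<sigma>, 0) (q s) \<le> s"
    using start rest_nonneg[of "q s"] s by (auto simp: race_dist_def min_def split: if_splits)
  show rest1: "1 \<le> rest (q s)"
    using rest_lipschitz[of "(\<sigma>, 0)" "q s"] start riv s by simp
  have "q s \<in> board"
    using q s by (auto simp: paths_def)
  then have board: "1 < \<bar>u\<bar> \<or> \<bar>u\<bar> = 1 \<and> h = 0"
    using rest1 uh rest_target by (auto simp: board_def)
  have formula: "3 - 9/10 * \<bar>u\<bar> + 1/10 * toll u - \<bar>h\<bar> \<le> 3 - 9/10 * (1 + s)"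
    using sched uh unfolding race_dist_target rest_def by simp
  define x where "x = \<sigma> * u - 1"
  \<comment> \<open>A point of the other comb would be at least 2 away from the start.\<close>
  have "\<sigma> * u - 1 + \<bar>h\<bar> \<le> s" "\<bar>u\<bar> = 1 + (\<sigma> * u - 1)" "0 \<le> \<sigma> * u - 1"
    using \<sigma> riv board s uh by (auto simp: river_def split: if_splits)
  then have xh: "x + \<bar>h\<bar> \<le> s" and u: "\<bar>u\<bar> = 1 + x" and "0 \<le> x"
    unfolding x_def by blast+
  have near: "\<bar>\<sigma> * (1 + s) - u\<bar> = s - x"
    using \<sigma> xh by (auto simp: x_def)
  have depth: "9/10 * (s - x) + 1/10 * toll u \<le> \<bar>h\<bar>"
    using formula unfolding u by (simp add: field_simps)
  have "9/10 * (s - x) \<le> \<bar>h\<bar>"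
    using depth toll_nonneg[of u] by (simp add: field_simps)
  then show "9/10 * (s - (\<sigma> * fst (q s) - 1)) \<le> \<bar>snd (q s)\<bar>"
    by (simp only: x_def uh fst_conv snd_conv)
  have "toll u \<le> s - x"
    using depth xh by (simp add: field_simps)
  moreover have "toll (\<sigma> * (1 + s)) - toll u \<le> s - x"
    using toll_lipschitz[of "\<sigma> * (1 + s)" u] unfolding near by (rule abs_le_D1)
  ultimately have "x \<le> 3/4 * s"
    using toll by linarith
  then show "\<sigma> * fst (q s) - 1 \<le> 3/4 * s"
    by (simp only: x_def uh fst_conv)
  \<comment> \<open>At the start there is no tooth, hence no height, which is behind schedule.\<close>
  have "x \<noteq> 0"
    using board u depth s toll_nonneg[of u] by auto
  then show "1 < \<sigma> * fst (q s)"
    using \<open>0 \<le> x\<close> uh by (simp add: x_def)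
qed

text \<open>
  The opponent, whose comb is on the side of \<open>- \<sigma>\<close>, can leave toll-free at the times
  \<open>s\<^sub>n = s\<^sub>0 / 4\<^sup>n\<close>, while the player's toll is large at these distances.  The answer \<open>q\<close> to a walk
  along the spine is compared at these times.
\<close>

lemma no_drawing_strategy:
  assumes \<sigma>: "\<sigma> = 1 \<or> \<sigma> = -1" and s0: "0 < s0" "s0 \<le> 1"
    and free: "\<And>n. toll (- \<sigma> * (1 + s0 * (1/4) ^ n)) = 0"
    and dear: "\<And>n. s0 * (1/4) ^ n / 2 \<le> toll (\<sigma> * (1 + s0 * (1/4) ^ n))"
  shows "\<not> drawing_strategy board race_dist (\<sigma>, 0) (- \<sigma>, 0) target G"
proof
  assume G: "drawing_strategy board race_dist (\<sigma>, 0) (- \<sigma>, 0) target G"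
  have \<sigma>': "- \<sigma> = 1 \<or> - \<sigma> = -1" using \<sigma> by auto
  define q where "q = G (run (- \<sigma>) 1)"
  have w: "run (- \<sigma>) 1 \<in> paths board race_dist (- \<sigma>, 0)"
    using run_in_paths[OF \<sigma>'] by simp
  have q: "q \<in> paths board race_dist (\<sigma>, 0)"
    using G w by (auto simp: q_def drawing_strategy_def strategy_def)
  define s where "s n = s0 * (1/4) ^ n" for n :: nat
  have s: "0 < s n" "s n \<le> 1" for n
    using s0 mult_mono[of s0 1 "(1/4) ^ n" 1] by (auto simp: s_def power_le_one)
  have start: "s n \<le> race_dist (\<sigma>, 0) target" for n
    using s(2)[of n] \<sigma> toll_nonneg[of \<sigma>] unfolding race_dist_target
    by (auto simp: rest_def)
  have sched: "race_dist (q (s n)) target \<le> 3 - 9/10 * (1 + s n)" for n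
    unfolding q_def
  proof (rule drawing_strategy_dist_le[OF G run_in_paths[OF \<sigma>', of "s n"] w])
    show "run (- \<sigma>) (s n) (s n + (3 - 9/10 * (1 + s n))) = target"
      using run_reaches_target[OF \<sigma>' s] free by (simp add: s_def)
  qed (use s[of n] start[of n] in \<open>auto intro: run_agree\<close>)
  note pos = position_if_on_schedule[OF \<sigma> s q sched, unfolded s_def, OF dear, folded s_def]
  \<comment> \<open>Changing from a tooth at distance \<open>x\<close> to one at \<open>x'\<close> takes \<open>\<bar>h\<bar> + \<bar>x - x'\<bar> + \<bar>h'\<bar>\<close>.  With the
    heights forced by the schedule at times \<open>s\<close> and \<open>4 s\<close>, this is at least
    \<open>9/2 s - 19/10 x + x' / 10\<close>, which exceeds the available \<open>3 s\<close> because \<open>x \<le> 3/4 s\<close> and \<open>x' > 0\<close>.\<close>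
  have tooth: "fst (q (s (Suc n))) = fst (q (s n))" for n
  proof (rule ccontr)
    assume ne: "fst (q (s (Suc n))) \<noteq> fst (q (s n))"
    have quarter: "s n = 4 * s (Suc n)" by (simp add: s_def)
    have "race_dist (q (s (Suc n))) (q (s n)) \<le> \<bar>s (Suc n) - s n\<bar>"
      using q s[of n] s[of "Suc n"] by (simp add: paths_def)
    then have "river (q (s (Suc n))) (q (s n)) \<le> 3 * s (Suc n)"
      using pos(4)[of n] pos(4)[of "Suc n"] quarter s[of n] s[of "Suc n"]
      by (auto simp: race_dist_def min_def split: if_splits)
    moreover have "\<sigma> * fst (q (s n)) - \<sigma> * fst (q (s (Suc n)))
        \<le> \<bar>fst (q (s (Suc n))) - fst (q (s n))\<bar>"
      using \<sigma> by auto
    ultimately show False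
      using ne pos(1,2,3)[of n] pos(1,2,3)[of "Suc n"] quarter s(1)[of "Suc n"]
      by (simp add: river_def)
  qed
  have const: "fst (q (s n)) = fst (q (s 0))" for n
    by (induction n) (simp_all add: tooth)
  have "(\<lambda>n. 3/4 * s n) \<longlonglongrightarrow> 3/4 * (s0 * 0)"
    unfolding s_def by (intro tendsto_mult tendsto_const LIMSEQ_realpow_zero) auto
  then have "\<sigma> * fst (q (s 0)) - 1 \<le> 3/4 * (s0 * 0)"
  proof (rule LIMSEQ_le_const)
    have "\<sigma> * fst (q (s 0)) - 1 \<le> 3/4 * s n" for n
      using pos(2)[of n] unfolding const[of n] .
    then show "\<exists>N. \<forall>n\<ge>N. \<sigma> * fst (q (s 0)) - 1 \<le> 3/4 * s n"
      by blast
  qed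
  then show False
    using pos(1)[of 0] by simp
qed

end

section \<open>The toll\<close>

text \<open>The toll-free points of both spines; the toll is the distance to the nearest of them.\<close>

definition exits :: "real set" where
  "exits = range (\<lambda>n. 1 + (1/4) ^ n) \<union> range (\<lambda>n. - (1 + 1/2 * (1/4) ^ n))"

text \<open>
  The quotient of toll-free distances of different players is an odd power of 2, so they differ by
  a factor of at least 2.
\<close>

lemma powers_of_4_gap:
  fixes m n :: nat
  shows "(1/4) ^ n / 2 \<le> \<bar>(1/4 :: real) ^ n - 1/2 * (1/4) ^ m\<bar>"
    and "1/2 * (1/4) ^ n / 2 \<le> \<bar>1/2 * (1/4 :: real) ^ n - (1/4) ^ m\<bar>"
proof -
  have le: "(1/4 :: real) ^ j \<le> (1/4) ^ i" if "i \<le> j" for i j :: nat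
    using that by (rule power_decreasing) auto
  have less: "4 * (1/4 :: real) ^ j \<le> (1/4) ^ i" if "i < j" for i j :: nat
    using le[of "Suc i" j] that by simp
  have pos: "0 < (1/4 :: real) ^ n"
    by simp
  show "(1/4) ^ n / 2 \<le> \<bar>(1/4 :: real) ^ n - 1/2 * (1/4) ^ m\<bar>"
    using le[of n m] less[of m n] pos by (cases "m < n") linarith+
  show "1/2 * (1/4) ^ n / 2 \<le> \<bar>1/2 * (1/4 :: real) ^ n - (1/4) ^ m\<bar>"
    using le[of m n] less[of n m] pos by (cases "m \<le> n") linarith+
qed

theorem theorem12:
  shows "\<exists>(X :: (real \<times> real) set) d xA xB y.
    Metric_space X d \<and> xA \<in> X \<and> xB \<in> X \<and> y \<in> X \<and>
    \<not> (\<exists>G. drawing_strategy X d xA xB y G) \<and>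
    \<not> (\<exists>G. drawing_strategy X d xB xA y G)"
proof -
  interpret toll_race "\<lambda>u. infdist u exits"
  proof
    show "\<bar>infdist u exits - infdist v exits\<bar> \<le> \<bar>u - v\<bar>" for u v :: real
      using infdist_triangle_abs[of u exits v] by (simp add: dist_real_def)
  qed (rule infdist_nonneg)
  have infdist_ge: "b \<le> infdist u exits" if "\<And>e. e \<in> exits \<Longrightarrow> b \<le> \<bar>u - e\<bar>" for b u :: real
  proof -
    have "exits \<noteq> {}" by (auto simp: exits_def)
    then show ?thesis
      using that by (auto simp: infdist_notempty dist_real_def intro!: cINF_greatest)
  qed
  have free_right: "infdist (1 + (1/4) ^ n) exits = 0" for n
    by (rule infdist_zero) (unfold exits_def, rule UnI1, rule rangeI)
  have free_left: "infdist (- (1 + 1/2 * (1/4) ^ n)) exits = 0" for n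
    by (rule infdist_zero) (unfold exits_def, rule UnI2, rule rangeI)
  have pos: "0 < (1/4 :: real) ^ n" "(1/4 :: real) ^ n \<le> 1" for n :: nat
    by (simp_all add: power_le_one)
  have dear_right: "1/2 * (1/4) ^ n / 2 \<le> infdist (1 + 1/2 * (1/4) ^ n) exits" for n
  proof (rule infdist_ge)
    fix e assume "e \<in> exits"
    then obtain m where "e = 1 + (1/4) ^ m \<or> e = - (1 + 1/2 * (1/4) ^ m)"
      by (auto simp only: exits_def)
    then show "1/2 * (1/4) ^ n / 2 \<le> \<bar>1 + 1/2 * (1/4) ^ n - e\<bar>"
      using powers_of_4_gap(2)[of n m] pos[of n] pos(1)[of m] by linarith
  qed
  have dear_left: "(1/4) ^ n / 2 \<le> infdist (- (1 + (1/4) ^ n)) exits" for n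
  proof (rule infdist_ge)
    fix e assume "e \<in> exits"
    then obtain m where "e = 1 + (1/4) ^ m \<or> e = - (1 + 1/2 * (1/4) ^ m)"
      by (auto simp only: exits_def)
    then show "(1/4) ^ n / 2 \<le> \<bar>- (1 + (1/4) ^ n) - e\<bar>"
      using powers_of_4_gap(1)[of n m] pos[of n] pos(1)[of m] by linarith
  qed
  have start: "(1, 0) \<in> board" "(-1, 0) \<in> board"
    using infdist_nonneg[of 1 exits] infdist_nonneg[of "-1" exits]
    by (auto simp: board_def rest_def)
  have "\<not> drawing_strategy board race_dist (1, 0) (-1, 0) target G" for G
    using no_drawing_strategy[of 1 "1/2" G] free_left dear_right by simp
  moreover have "\<not> drawing_strategy board race_dist (-1, 0) (1, 0) target G" for G
    using no_drawing_strategy[of "-1" 1 G] free_right dear_left by simp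
  moreover have "target \<in> board"
    by (simp add: board_def)
  ultimately show ?thesis
    using Metric_space_race start by blast
qed

end
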